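(* Let $\mathcal{X}=\{1,\dots,m\}$, let $q_1,q_2$ be positive measures on $\mathcal{X}$ with full support, and let $A_1\in\mathbb{R}^{d_1\times m}$, $A_2\in\mathbb{R}^{d_2\times m}$ be matrices whose row spans both contain $(1,\dots,1)$. If $\mathcal{C}(A_1)=\mathcal{C}(A_2)$, then the possible support sets of the corresponding exponential families coincide: $$\{\operatorname{supp}(p): p\in\overline{\mathcal{E}_{q_1,A_1}}\}=\{\operatorname{supp}(p): p\in\overline{\mathcal{E}_{q_2,A_2}}\}.$$
   Context: $\mathcal{P}(\mathcal{X})$ is the open simplex of probability measures with full support on $\mathcal{X}$, viewed as a subset of $\mathbb{R}^{\mathcal{X}}$; closures are taken in the standard topology of $\mathbb{R}^{\mathcal{X}}$. For a matrix $A\in\mathbb{R}^{d\times m}$ with columns $a_x\in\mathbb{R}^d$, $x\in\mathcal{X}$, and a positive measure $q$ on $\mathcal{X}$ with full support, the exponential family associated with $q$ and $A$ is $$\mathcal{E}_{q,A}=\Big\{p_\theta\in\mathcal{P}(\mathcal{X}) : p_\theta(x)=\frac{q(x)}{Z_\theta}\exp(\theta^{T}a_x),\ \theta\in\mathbb{R}^d\Big\},\qquad Z_\theta=\sum_{x\in\mathcal{X}}q(x)\exp(\theta^{T}a_x).$$ For $n\in\mathbb{R}^{\mathcal{X}}$ put $n^{+}(x)=\max(n(x),0)$, $n^{-}(x)=\max(-n(x),0)$ and $\operatorname{supp}(n)=\{x:n(x)\neq0\}$. A circuit vector of $A$ is a nonzero vector $n\in\ker A$ with inclusion-minimal support, i.e.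 if $n'\in\ker A$ satisfies $\operatorname{supp}(n')\subseteq\operatorname{supp}(n)$, then $n'=\lambda n$ for some $\lambda\in\mathbb{R}$. For $n\in\mathbb{R}^{\mathcal{X}}$ let $\operatorname{sgn}(n)=(\operatorname{supp}(n^{+}),\operatorname{supp}(n^{-}))$. The set of signed circuits of $A$ is $\mathcal{C}(A)=\{\operatorname{sgn}(c): c \text{ a circuit vector of } A\}$. *)

theory Defs
  imports "HOL-Analysis.Analysis"
begin

definition full_support :: "real ^ 'm::finite \<Rightarrow> bool" where
  "full_support q \<longleftrightarrow> (\<forall>x. q $ x > 0)"

definition open_simplex :: "(real ^ 'm::finite) set" where
  "open_simplex = {p. full_support p \<and> (\<Sum>x\<in>UNIV. p $ x) = 1}"

definition partition_fun :: "real ^ 'm::finite \<Rightarrow> real ^ 'm ^ 'd::finite \<Rightarrow> real ^ 'd \<Rightarrow> real" where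
  "partition_fun q A \<theta> = (\<Sum>x\<in>UNIV. q $ x * exp (\<theta> \<bullet> column x A))"

definition exp_family :: "real ^ 'm::finite \<Rightarrow> real ^ 'm ^ 'd::finite \<Rightarrow> (real ^ 'm) set" where
  "exp_family q A =
    {p \<in> open_simplex. \<exists>\<theta>. \<forall>x. p $ x = q $ x / partition_fun q A \<theta> * exp (\<theta> \<bullet> column x A)}"

definition supp :: "real ^ 'm::finite \<Rightarrow> 'm set" where
  "supp n = {x. n $ x \<noteq> 0}"

definition pos_part :: "real ^ 'm::finite \<Rightarrow> real ^ 'm" where
  "pos_part n = (\<chi> x. max (n $ x) 0)"

definition neg_part :: "real ^ 'm::finite \<Rightarrow> real ^ 'm" where
  "neg_part n = (\<chi> x. max (- n $ x) 0)"

definition sign_pair :: "real ^ 'm::finite \<Rightarrow> 'm set \<times> 'm set" where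
  "sign_pair n = (supp (pos_part n), supp (neg_part n))"

definition circuit_vector :: "real ^ 'm::finite ^ 'd::finite \<Rightarrow> real ^ 'm \<Rightarrow> bool" where
  "circuit_vector A n \<longleftrightarrow> n \<noteq> 0 \<and> A *v n = 0 \<and>
    (\<forall>n'. A *v n' = 0 \<longrightarrow> supp n' \<subseteq> supp n \<longrightarrow> (\<exists>r::real. n' = r *\<^sub>R n))"

definition signed_circuits :: "real ^ 'm::finite ^ 'd::finite \<Rightarrow> ('m set \<times> 'm set) set" where
  "signed_circuits A = {sign_pair c | c. circuit_vector A c}"

end

theory Submission
  imports Defs
begin

text \<open>
  The proof describes the support sets of the closure of an exponential family by the signed
  circuits alone.  A nonempty set \<open>S\<close> is the support of some point of the closure exactly if, for
  every signed circuit \<open>(P, N)\<close>, the set \<open>P\<close> is contained in \<open>S\<close> if and only if \<open>N\<close> is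
  (\<open>supports_closure_exp_family\<close>).  This criterion refers to the family only through its signed
  circuits, so families with equal signed circuits have equal support sets.

  The criterion is necessary because every member of the family satisfies, for each kernel vector
  \<open>n\<close>, the binomial equation
  \<open>\<Prod>\<^bsub>n x > 0\<^esub> (p x / q x) powr n x = \<Prod>\<^bsub>n x < 0\<^esub> (p x / q x) powr (- n x)\<close>.
  This is where \<open>(1, \<dots>, 1)\<close> being in the row span enters: it makes the normalising constants
  cancel.  All exponents are positive, so the equation passes to limits, and
  each side vanishes as soon as one of its factors does.

  For sufficiency, every entry of a kernel vector is met by a circuit whose signs agree
  with those of the vector (\<open>conformal_circuit_exists\<close>), so the criterion extends from circuits to
  the whole kernel.  Then no kernel vector can be nonnegative and nonzero off \<open>S\<close>, and
  a separating hyperplane yields a parameter \<open>\<theta>\<close> for which \<open>\<theta> \<bullet> a\<^sub>x\<close> is zero on \<open>S\<close> and positive off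
  \<open>S\<close> (\<open>exposing_parameter_exists\<close>).  Along the ray \<open>- k \<theta>\<close> the family converges to \<open>q\<close>
  restricted to \<open>S\<close> and normalised.
\<close>

section \<open>Signs and kernel vectors\<close>

lemma supp_pos_part: "supp (pos_part n) = {x. n $ x > 0}"
  by (auto simp: supp_def pos_part_def max_def)

lemma supp_neg_part: "supp (neg_part n) = {x. n $ x < 0}"
  by (auto simp: supp_def neg_part_def max_def)

lemma inner_matrix_vector_mult_columns:
  fixes A :: "real ^ 'm::finite ^ 'd::finite"
  shows "\<theta> \<bullet> (A *v n) = (\<Sum>x\<in>UNIV. n $ x * (\<theta> \<bullet> column x A))"
  by (simp add: matrix_mult_sum inner_sum_right scalar_mult_eq_scaleR)

text \<open>
  The range of the transpose of \<open>A\<close> is the orthogonal complement of its kernel, and its elements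
  are the vectors \<open>x \<mapsto> \<theta> \<bullet> a\<^sub>x\<close>.
\<close>
lemma orthogonal_to_kernel_imp_parameter:
  fixes A :: "real ^ 'm::finite ^ 'd::finite"
  assumes "\<And>n. A *v n = 0 \<Longrightarrow> a \<bullet> n = 0"
  obtains \<theta> where "\<And>x. \<theta> \<bullet> column x A = a $ x"
proof -
  let ?R = "range (\<lambda>\<theta>. transpose A *v \<theta>)"
  have ker: "(\<lambda>n. A *v n) -` {0} = ?R\<^sup>\<bottom>"
    using ker_orthogonal_comp_adjoint[of "\<lambda>n. A *v n"] by (simp only: adjoint_matrix matrix_vector_mul_linear)
  have "a \<in> ?R\<^sup>\<bottom>\<^sup>\<bottom>"
    using assms unfolding ker[symmetric] by (auto simp: orthogonal_comp_def orthogonal_def inner_commute)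
  moreover have "subspace ?R"
    by (intro linear_subspace_image subspace_UNIV matrix_vector_mul_linear)
  ultimately obtain \<theta> where \<theta>: "a = transpose A *v \<theta>"
    using orthogonal_comp_self by blast
  have "\<theta> \<bullet> column x A = a $ x" for x
    by (simp add: \<theta> inner_vec_def column_def vector_matrix_mult_def mult.commute)
  then show thesis using that by blast
qed

section \<open>Conformal circuits\<close>

text \<open>
  If \<open>n\<close> itself is not a circuit vector, some kernel vector \<open>m\<close> supported in \<open>supp n\<close> is not a
  multiple of \<open>n\<close>, and subtracting a multiple of \<open>n\<close> makes \<open>m\<close> vanish at the prescribed point.
  Moving from \<open>n\<close> in the direction \<open>m\<close> until the first coordinate reaches zero
  preserves the remaining signs and the entry at the prescribed point but shrinks the support.
\<close>
lemma conformal_circuit_exists: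
  fixes A :: "real ^ 'm::finite ^ 'd::finite"
  assumes "A *v n = 0" and "n $ x \<noteq> 0"
  shows "\<exists>c. circuit_vector A c \<and> c $ x \<noteq> 0 \<and>
    (\<forall>y. c $ y > 0 \<longrightarrow> n $ y > 0) \<and> (\<forall>y. c $ y < 0 \<longrightarrow> n $ y < 0)"
  using assms
proof (induction "card (supp n)" arbitrary: n rule: less_induct)
  case less
  show ?case
  proof (cases "circuit_vector A n")
    case True
    then show ?thesis using less.prems by blast
  next
    case False
    have "n \<noteq> 0" using less.prems by auto
    with False less.prems obtain n' where n': "A *v n' = 0" "supp n' \<subseteq> supp n" "\<forall>r. n' \<noteq> r *\<^sub>R n"
      by (auto simp: circuit_vector_def)
    define m0 where "m0 = n' - (n' $ x / n $ x) *\<^sub>R n"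
    have m0: "A *v m0 = 0" "m0 $ x = 0" "supp m0 \<subseteq> supp n" "m0 \<noteq> 0"
      using n' less.prems
      by (auto simp: m0_def matrix_vector_mult_diff_distrib matrix_vector_mult_scaleR supp_def)
    obtain y0 where y0: "m0 $ y0 \<noteq> 0" using m0(4) by (auto simp: vec_eq_iff)
    have ny0: "n $ y0 \<noteq> 0" using y0 m0(3) by (auto simp: supp_def)
    \<comment> \<open>The sign is chosen such that some coordinate moves towards zero.\<close>
    define m where "m = (- sgn (m0 $ y0 * n $ y0)) *\<^sub>R m0"
    have m: "A *v m = 0" "m $ x = 0" "supp m \<subseteq> supp n"
      unfolding m_def matrix_vector_mult_scaleR using m0 by (auto simp: supp_def)
    have my0: "m $ y0 * n $ y0 < 0"
      using y0 ny0 by (auto simp: m_def sgn_if mult_less_0_iff zero_less_mult_iff)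
    define D where "D = {y. m $ y * n $ y < 0}"
    define t where "t = Min ((\<lambda>y. - n $ y / m $ y) ` D)"
    have D: "finite D" "D \<noteq> {}" using my0 by (auto simp: D_def)
    have "t \<in> (\<lambda>y. - n $ y / m $ y) ` D" unfolding t_def using D by (intro Min_in) auto
    then obtain z where z: "z \<in> D" "t = - n $ z / m $ z" by blast
    have t_le: "t \<le> - n $ y / m $ y" if "y \<in> D" for y
      unfolding t_def using D that by (intro Min_le) auto
    have t_pos: "t > 0"
      using z by (auto simp: D_def mult_less_0_iff divide_neg_pos divide_pos_neg)
    define k where "k = n + t *\<^sub>R m"
    have k_ker: "A *v k = 0"
      using less.prems m by (simp add: k_def matrix_vector_right_distrib matrix_vector_mult_scaleR)
    have kx: "k $ x \<noteq> 0" using less.prems m by (simp add: k_def)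
    have kz: "k $ z = 0" "n $ z \<noteq> 0" using z by (auto simp: k_def D_def)
    have m_zero: "m $ y = 0" if "n $ y = 0" for y
      using m(3) that by (auto simp: supp_def)
    have nonneg: "k $ y \<ge> 0" if "n $ y > 0" for y
    proof (cases "m $ y < 0")
      case True
      then have "y \<in> D" using that by (simp add: D_def mult_neg_pos)
      then show ?thesis using t_le[of y] True by (simp add: k_def field_simps)
    qed (use that t_pos in \<open>simp add: k_def\<close>)
    have nonpos: "k $ y \<le> 0" if "n $ y < 0" for y
    proof (cases "m $ y > 0")
      case True
      then have "y \<in> D" using that by (simp add: D_def mult_pos_neg)
      then show ?thesis using t_le[of y] True by (simp add: k_def field_simps)
    next
      case False
      then have "t * m $ y \<le> 0" using t_pos by (simp add: mult_le_0_iff)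
      then show ?thesis using that by (simp add: k_def)
    qed
    have k_zero: "k $ y = 0" if "n $ y = 0" for y using m_zero that by (simp add: k_def)
    have conf: "k $ y > 0 \<longrightarrow> n $ y > 0" "k $ y < 0 \<longrightarrow> n $ y < 0" for y
      using nonneg[of y] nonpos[of y] k_zero[of y] by (metis linorder_neqE_linordered_idom not_le)+
    have "supp k \<subset> supp n" using k_zero kz by (auto simp: supp_def)
    then have "card (supp k) < card (supp n)" by (simp add: psubset_card_mono)
    from less.hyps[OF this k_ker kx] conf show ?thesis by blast
  qed
qed

text \<open>
  Each negative entry of \<open>n\<close> is a negative entry of a conformal circuit vector, whose positive
  entries are among those of \<open>n\<close> and hence in \<open>S\<close>.
\<close>
lemma circuit_condition_extends_to_kernel:
  fixes A :: "real ^ 'm::finite ^ 'd::finite"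
  assumes S: "\<And>P N. (P, N) \<in> signed_circuits A \<Longrightarrow> P \<subseteq> S \<Longrightarrow> N \<subseteq> S"
    and n: "A *v n = 0" and pos: "supp (pos_part n) \<subseteq> S"
  shows "supp (neg_part n) \<subseteq> S"
proof
  fix x assume "x \<in> supp (neg_part n)"
  then have x: "n $ x < 0" by (simp add: supp_neg_part)
  then obtain c where c: "circuit_vector A c" "c $ x \<noteq> 0"
      "\<And>y. c $ y > 0 \<Longrightarrow> n $ y > 0" "\<And>y. c $ y < 0 \<Longrightarrow> n $ y < 0"
    using conformal_circuit_exists[OF n, of x] by auto
  have "supp (neg_part c) \<subseteq> S"
  proof (rule S)
    show "(supp (pos_part c), supp (neg_part c)) \<in> signed_circuits A"
      using c(1) by (auto simp: signed_circuits_def sign_pair_def)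
    show "supp (pos_part c) \<subseteq> S"
      using pos c(3) by (auto simp: supp_pos_part)
  qed
  moreover have "c $ x < 0" using c(2) c(3)[of x] x by linarith
  ultimately show "x \<in> S" by (auto simp: supp_neg_part)
qed

section \<open>Supports of limit points satisfy the circuit condition\<close>

lemma partition_fun_pos:
  assumes "full_support q"
  shows "partition_fun q A \<theta> > 0"
  unfolding partition_fun_def using assms
  by (intro sum_pos) (auto simp: full_support_def)

text \<open>
  Taking logarithms, the equation says that \<open>ln (p / q)\<close> is orthogonal to the kernel.  It is
  the sum of a row-space vector and a constant vector, and the latter also lies in the row space.
\<close>
lemma exp_family_binomial_equation:
  fixes A :: "real ^ 'm::finite ^ 'd::finite"
  assumes q: "full_support q" and ones: "(\<chi> x. 1) \<in> span (rows A)"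
    and p: "p \<in> exp_family q A" and n: "A *v n = 0"
  shows "(\<Prod>x\<in>supp (pos_part n). (p $ x / q $ x) powr (n $ x)) =
         (\<Prod>x\<in>supp (neg_part n). (p $ x / q $ x) powr (- n $ x))"
proof -
  obtain \<theta> where \<theta>: "\<And>x. p $ x = q $ x / partition_fun q A \<theta> * exp (\<theta> \<bullet> column x A)"
    using p by (auto simp: exp_family_def)
  let ?Z = "partition_fun q A \<theta>"
  define r where "r x = \<theta> \<bullet> column x A - ln ?Z" for x
  have Z: "?Z > 0" by (rule partition_fun_pos[OF q])
  have ratio: "p $ x / q $ x = exp (r x)" for x
  proof -
    have "q $ x \<noteq> 0" using q by (metis full_support_def less_irrefl)
    then show ?thesis using Z by (simp add: \<theta> r_def exp_diff)
  qed
  have sum_n: "(\<Sum>x\<in>UNIV. n $ x) = 0"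
    using orthogonal_nullspace_rowspace[OF n ones] by (simp add: orthogonal_def inner_vec_def)
  have "(\<Sum>x\<in>UNIV. n $ x * r x) = \<theta> \<bullet> (A *v n) - ln ?Z * (\<Sum>x\<in>UNIV. n $ x)"
    by (simp add: inner_matrix_vector_mult_columns r_def right_diff_distrib sum_subtractf
        sum_distrib_left mult.commute[of "ln _"])
  then have "0 = (\<Sum>x\<in>UNIV. n $ x * r x)" using n sum_n by simp
  also have "\<dots> = (\<Sum>x\<in>supp (pos_part n) \<union> supp (neg_part n). n $ x * r x)"
    by (intro sum.mono_neutral_right) (auto simp: supp_pos_part supp_neg_part)
  also have "\<dots> = (\<Sum>x\<in>supp (pos_part n). n $ x * r x) + (\<Sum>x\<in>supp (neg_part n). n $ x * r x)"
    by (intro sum.union_disjoint) (auto simp: supp_pos_part supp_neg_part)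
  finally have "(\<Sum>x\<in>supp (pos_part n). n $ x * r x) = (\<Sum>x\<in>supp (neg_part n). - n $ x * r x)"
    by (simp add: sum_negf)
  then show ?thesis
    by (simp add: ratio powr_def exp_sum[symmetric])
qed

lemma closure_exp_family_binomial_equation:
  fixes A :: "real ^ 'm::finite ^ 'd::finite"
  assumes q: "full_support q" and ones: "(\<chi> x. 1) \<in> span (rows A)"
    and p: "p \<in> closure (exp_family q A)" and n: "A *v n = 0"
  shows "(\<Prod>x\<in>supp (pos_part n). (p $ x / q $ x) powr (n $ x)) =
         (\<Prod>x\<in>supp (neg_part n). (p $ x / q $ x) powr (- n $ x))"
proof -
  obtain s where s: "\<And>k. s k \<in> exp_family q A" "s \<longlonglongrightarrow> p"
    using p unfolding closure_sequential by blast
  have q_pos: "q $ x > 0" for x using q by (simp add: full_support_def)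
  have s_pos: "s k $ x > 0" for k x
    using s(1)[of k] by (simp add: exp_family_def open_simplex_def full_support_def)
  \<comment> \<open>At a zero of \<open>p\<close> the power is continuous only because its exponent is positive.\<close>
  have lim: "(\<lambda>k. \<Prod>x\<in>B. (s k $ x / q $ x) powr e x) \<longlonglongrightarrow> (\<Prod>x\<in>B. (p $ x / q $ x) powr e x)"
    if "\<And>x. x \<in> B \<Longrightarrow> e x > 0" for B and e :: "'m \<Rightarrow> real"
  proof (intro tendsto_prod tendsto_powr')
    fix x
    show "(\<lambda>k. s k $ x / q $ x) \<longlonglongrightarrow> p $ x / q $ x"
      using q_pos[of x] by (intro tendsto_divide tendsto_vec_nth s tendsto_const) auto
    show "p $ x / q $ x \<noteq> 0 \<or> e x > 0 \<and> (\<forall>\<^sub>F k in sequentially. s k $ x / q $ x \<ge> 0)" if "x \<in> B"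
      using s_pos q_pos \<open>\<And>x. x \<in> B \<Longrightarrow> e x > 0\<close>[OF that] by (simp add: less_imp_le)
  qed (rule tendsto_const)
  show ?thesis
  proof (rule LIMSEQ_unique)
    show "(\<lambda>k. \<Prod>x\<in>supp (pos_part n). (s k $ x / q $ x) powr (n $ x))
        \<longlonglongrightarrow> (\<Prod>x\<in>supp (pos_part n). (p $ x / q $ x) powr (n $ x))"
      by (rule lim) (simp add: supp_pos_part)
    show "(\<lambda>k. \<Prod>x\<in>supp (pos_part n). (s k $ x / q $ x) powr (n $ x))
        \<longlonglongrightarrow> (\<Prod>x\<in>supp (neg_part n). (p $ x / q $ x) powr (- n $ x))"
      unfolding exp_family_binomial_equation[OF q ones s(1) n]
      by (rule lim) (simp add: supp_neg_part)
  qed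
qed

text \<open>
  Each side of the binomial equation is nonzero exactly if its index set lies in the support of
  \<open>p\<close>.
\<close>
lemma supp_closure_exp_family_kernel_condition:
  fixes A :: "real ^ 'm::finite ^ 'd::finite"
  assumes q: "full_support q" and ones: "(\<chi> x. 1) \<in> span (rows A)"
    and p: "p \<in> closure (exp_family q A)" and n: "A *v n = 0"
  shows "supp (pos_part n) \<subseteq> supp p \<longleftrightarrow> supp (neg_part n) \<subseteq> supp p"
proof -
  have "q $ x \<noteq> 0" for x using q by (metis full_support_def less_irrefl)
  then have "(\<Prod>x\<in>B. (p $ x / q $ x) powr e x) \<noteq> 0 \<longleftrightarrow> B \<subseteq> supp p" for B e
    by (auto simp: supp_def)
  with closure_exp_family_binomial_equation[OF assms] show ?thesis by metis
qed

lemma supp_closure_exp_family_nonempty: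
  assumes "p \<in> closure (exp_family q A)"
  shows "supp p \<noteq> {}"
proof
  assume "supp p = {}"
  then have "(\<Sum>x\<in>UNIV. p $ x) = 0" by (simp add: supp_def)
  moreover have "closure (exp_family q A) \<subseteq> {p. (\<Sum>x\<in>UNIV. p $ x) = 1}"
    by (intro closure_minimal closed_Collect_eq continuous_intros)
      (auto simp: exp_family_def open_simplex_def)
  ultimately show False using assms by auto
qed

section \<open>Sets satisfying the circuit condition are supports\<close>

text \<open>
  A theorem of the alternative.  The vectors that agree off \<open>S\<close> with some kernel vector form a
  subspace \<open>M\<close>.  By hypothesis \<open>M\<close> misses the simplex spanned by the unit vectors
  off \<open>S\<close>, so some \<open>a\<close> is orthogonal to \<open>M\<close> and positive on that simplex.  Orthogonality to the
  vectors supported in \<open>S\<close> makes \<open>a\<close> vanish on \<open>S\<close>, and orthogonality to the kernel puts it in the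
  row space.
\<close>
lemma exposing_parameter_exists:
  fixes A :: "real ^ 'm::finite ^ 'd::finite"
  assumes alt: "\<And>n x. A *v n = 0 \<Longrightarrow> (\<And>y. y \<notin> S \<Longrightarrow> n $ y \<ge> 0) \<Longrightarrow> x \<notin> S \<Longrightarrow> n $ x = 0"
  obtains \<theta> where "\<And>x. x \<in> S \<Longrightarrow> \<theta> \<bullet> column x A = 0" "\<And>x. x \<notin> S \<Longrightarrow> \<theta> \<bullet> column x A > 0"
proof (cases "S = UNIV")
  case True
  then show thesis using that[of 0] by simp
next
  case False
  define M where "M = {u. \<exists>n. A *v n = 0 \<and> (\<forall>x. x \<notin> S \<longrightarrow> u $ x = n $ x)}"
  define T where "T = convex hull ((\<lambda>x. axis x 1 :: real ^ 'm) ` (- S))"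
  have M: "subspace M"
  proof (rule subspaceI)
    show "0 \<in> M" unfolding M_def by (auto intro!: exI[of _ 0])
    fix u v assume "u \<in> M" "v \<in> M"
    then obtain n n' where "A *v n = 0" "\<forall>x. x \<notin> S \<longrightarrow> u $ x = n $ x"
        "A *v n' = 0" "\<forall>x. x \<notin> S \<longrightarrow> v $ x = n' $ x"
      by (auto simp: M_def)
    then show "u + v \<in> M"
      unfolding M_def by (auto intro!: exI[of _ "n + n'"] simp: matrix_vector_right_distrib)
  next
    fix c u assume "u \<in> M"
    then obtain n where "A *v n = 0" "\<forall>x. x \<notin> S \<longrightarrow> u $ x = n $ x" by (auto simp: M_def)
    then show "c *\<^sub>R u \<in> M"
      unfolding M_def by (auto intro!: exI[of _ "c *\<^sub>R n"] simp: matrix_vector_mult_scaleR)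
  qed
  have T: "T \<subseteq> {v. (\<forall>x. v $ x \<ge> 0) \<and> (\<Sum>x\<in>- S. v $ x) = 1}" (is "_ \<subseteq> ?U")
    unfolding T_def
  proof (rule hull_minimal)
    show "convex ?U"
      by (auto simp: convex_def sum.distrib sum_distrib_left[symmetric])
    have "(\<Sum>x\<in>- S. (axis y 1 :: real ^ 'm) $ x) = 1" if "y \<notin> S" for y
      using that by (simp add: axis_def)
    then show "(\<lambda>x. axis x 1 :: real ^ 'm) ` (- S) \<subseteq> ?U"
      by (auto simp: axis_def)
  qed
  have disj: "M \<inter> T = {}"
  proof (rule ccontr)
    assume "M \<inter> T \<noteq> {}"
    then obtain v n where v: "\<forall>x. v $ x \<ge> 0" "(\<Sum>x\<in>- S. v $ x) = 1"
        and n: "A *v n = 0" "\<forall>x. x \<notin> S \<longrightarrow> v $ x = n $ x"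
      using T unfolding M_def by blast
    have "v $ x = 0" if "x \<notin> S" for x
      using alt[OF n(1), of x] n(2) v(1) that by metis
    then show False using v(2) by simp
  qed
  have "convex T" "compact T" "T \<noteq> {}"
    unfolding T_def using False by (auto simp: finite_imp_compact_convex_hull)
  then obtain a b where a: "\<And>u. u \<in> M \<Longrightarrow> a \<bullet> u < b" "\<And>v. v \<in> T \<Longrightarrow> a \<bullet> v > b"
    using separating_hyperplane_closed_compact[of M T] subspace_imp_convex[OF M]
      closed_subspace[OF M] disj by blast
  have b: "b > 0" using a(1)[of 0] subspace_0[OF M] by simp
  \<comment> \<open>A linear functional that is bounded above on a subspace vanishes there.\<close>
  have a_M: "a \<bullet> u = 0" if "u \<in> M" for u
  proof (rule ccontr)
    assume "a \<bullet> u \<noteq> 0"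
    then have "a \<bullet> ((b / (a \<bullet> u)) *\<^sub>R u) = b" by simp
    moreover have "(b / (a \<bullet> u)) *\<^sub>R u \<in> M" using M that by (rule subspace_scale)
    ultimately show False using a(1) by force
  qed
  have "a \<bullet> n = 0" if "A *v n = 0" for n
    using a_M[of n] that by (auto simp: M_def)
  then obtain \<theta> where \<theta>: "\<And>x. \<theta> \<bullet> column x A = a $ x"
    using orthogonal_to_kernel_imp_parameter by blast
  show thesis
  proof (rule that)
    fix x assume "x \<in> S"
    then have "axis x 1 \<in> M"
      unfolding M_def by (auto intro!: exI[of _ 0] simp: axis_def)
    then show "\<theta> \<bullet> column x A = 0" using a_M by (force simp: \<theta> inner_axis)
  next
    fix x assume "x \<notin> S"
    then have "axis x 1 \<in> T" unfolding T_def by (auto intro: hull_inc)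
    then show "\<theta> \<bullet> column x A > 0" using a(2) b by (force simp: \<theta> inner_axis)
  qed
qed

lemma exp_family_member:
  assumes q: "full_support q"
  shows "(\<chi> x. q $ x / partition_fun q A \<theta> * exp (\<theta> \<bullet> column x A)) \<in> exp_family q A"
proof -
  have Z: "partition_fun q A \<theta> > 0" by (rule partition_fun_pos[OF q])
  have "(\<Sum>x\<in>UNIV. q $ x / partition_fun q A \<theta> * exp (\<theta> \<bullet> column x A))
      = partition_fun q A \<theta> / partition_fun q A \<theta>"
    unfolding partition_fun_def[of q A \<theta>] sum_divide_distrib by simp
  then show ?thesis
    using q Z by (auto simp: exp_family_def open_simplex_def full_support_def)
qed

text \<open>
  Moving to infinity in the direction \<open>- \<theta>\<close> kills the weights off \<open>S\<close> and leaves those on \<open>S\<close>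
  unchanged.
\<close>
lemma exposed_set_is_support:
  fixes A :: "real ^ 'm::finite ^ 'd::finite"
  assumes q: "full_support q" and S: "S \<noteq> {}"
    and zero: "\<And>x. x \<in> S \<Longrightarrow> \<theta> \<bullet> column x A = 0"
    and pos: "\<And>x. x \<notin> S \<Longrightarrow> \<theta> \<bullet> column x A > 0"
  obtains p where "p \<in> closure (exp_family q A)" "supp p = S"
proof -
  have q_pos: "q $ x > 0" for x using q by (simp add: full_support_def)
  define Z where "Z = (\<Sum>x\<in>S. q $ x)"
  define p :: "real ^ 'm" where "p = (\<chi> x. if x \<in> S then q $ x / Z else 0)"
  define \<eta> where "\<eta> k = - real k *\<^sub>R \<theta>" for k
  define s where "s k = (\<chi> x. q $ x / partition_fun q A (\<eta> k) * exp (\<eta> k \<bullet> column x A))" for k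
  have Z: "Z > 0" unfolding Z_def using S q_pos by (intro sum_pos) auto
  have exp_lim: "(\<lambda>k. exp (\<eta> k \<bullet> column x A)) \<longlonglongrightarrow> (if x \<in> S then 1 else 0)" for x
  proof (cases "x \<in> S")
    case True
    then show ?thesis by (simp add: \<eta>_def zero)
  next
    case False
    have "exp (\<eta> k \<bullet> column x A) = exp (- (\<theta> \<bullet> column x A)) ^ k" for k
      by (simp add: \<eta>_def exp_of_nat_mult[symmetric])
    then show ?thesis using pos[OF False] False by (simp add: LIMSEQ_realpow_zero)
  qed
  have "(\<lambda>k. partition_fun q A (\<eta> k)) \<longlonglongrightarrow> (\<Sum>x\<in>UNIV. q $ x * (if x \<in> S then 1 else 0))"
    unfolding partition_fun_def by (intro tendsto_intros exp_lim)
  also have "(\<Sum>x\<in>UNIV. q $ x * (if x \<in> S then 1 else 0)) = Z"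
    unfolding Z_def by (simp add: if_distrib sum.If_cases cong: if_cong)
  finally have Z_lim: "(\<lambda>k. partition_fun q A (\<eta> k)) \<longlonglongrightarrow> Z" .
  have "(\<lambda>k. s k $ x) \<longlonglongrightarrow> p $ x" for x
  proof -
    have "(\<lambda>k. q $ x / partition_fun q A (\<eta> k) * exp (\<eta> k \<bullet> column x A))
        \<longlonglongrightarrow> q $ x / Z * (if x \<in> S then 1 else 0)"
      using Z by (intro tendsto_intros exp_lim Z_lim) auto
    then show ?thesis by (simp add: s_def p_def if_distrib cong: if_cong)
  qed
  then have "s \<longlonglongrightarrow> p" by (rule vec_tendstoI)
  moreover have "s k \<in> exp_family q A" for k
    unfolding s_def by (rule exp_family_member[OF q])
  ultimately have "p \<in> closure (exp_family q A)" unfolding closure_sequential by blast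
  moreover have "supp p = S"
    using Z q_pos by (auto simp: supp_def p_def less_imp_neq[symmetric])
  ultimately show thesis using that by blast
qed

section \<open>The circuit description of the support sets\<close>

theorem supports_closure_exp_family:
  fixes A :: "real ^ 'm::finite ^ 'd::finite"
  assumes q: "full_support q" and ones: "(\<chi> x. 1) \<in> span (rows A)"
  shows "{supp p | p. p \<in> closure (exp_family q A)} =
    {S. S \<noteq> {} \<and> (\<forall>(P, N)\<in>signed_circuits A. P \<subseteq> S \<longleftrightarrow> N \<subseteq> S)}" (is "?L = ?R")
proof
  show "?L \<subseteq> ?R"
  proof
    fix S assume "S \<in> ?L"
    then obtain p where p: "p \<in> closure (exp_family q A)" and S: "S = supp p" by blast
    have "P \<subseteq> S \<longleftrightarrow> N \<subseteq> S" if PN: "(P, N) \<in> signed_circuits A" for P N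
    proof -
      obtain c where "A *v c = 0" "P = supp (pos_part c)" "N = supp (neg_part c)"
        using PN by (auto simp: signed_circuits_def sign_pair_def circuit_vector_def)
      then show ?thesis
        using supp_closure_exp_family_kernel_condition[OF q ones p] S by simp
    qed
    then show "S \<in> ?R"
      using supp_closure_exp_family_nonempty[OF p] S by blast
  qed
  show "?R \<subseteq> ?L"
  proof
    fix S assume "S \<in> ?R"
    then have S: "S \<noteq> {}" and circ: "\<And>P N. (P, N) \<in> signed_circuits A \<Longrightarrow> P \<subseteq> S \<longleftrightarrow> N \<subseteq> S"
      by auto
    have "n $ x = 0"
      if n: "A *v n = 0" and nonneg: "\<And>y. y \<notin> S \<Longrightarrow> n $ y \<ge> 0" and x: "x \<notin> S" for n x
    proof -
      \<comment> \<open>The negative part of \<open>n\<close>, which is the positive part of \<open>- n\<close>, lies in \<open>S\<close>.\<close>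
      have "A *v (- n) = 0"
        using n by (metis diff_0 matrix_vector_mult_diff_distrib matrix_vector_mult_0_right diff_zero)
      moreover have "supp (pos_part (- n)) \<subseteq> S"
        using nonneg by (force simp: supp_pos_part)
      ultimately have "supp (neg_part (- n)) \<subseteq> S"
        using circ by (intro circuit_condition_extends_to_kernel[of A S "- n"]) auto
      then show "n $ x = 0" using nonneg[OF x] x by (force simp: supp_neg_part)
    qed
    then obtain \<theta> where \<theta>: "\<forall>x\<in>S. \<theta> \<bullet> column x A = 0" "\<forall>x. x \<notin> S \<longrightarrow> \<theta> \<bullet> column x A > 0"
      by (rule exposing_parameter_exists) auto
    obtain p where "p \<in> closure (exp_family q A)" "supp p = S"
      by (rule exposed_set_is_support[OF q S, of \<theta> A]) (use \<theta> in auto)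
    then show "S \<in> ?L" by blast
  qed
qed

theorem corollary19:
  fixes q1 q2 :: "real ^ 'm::finite"
    and A1 :: "real ^ 'm ^ 'd1::finite"
    and A2 :: "real ^ 'm ^ 'd2::finite"
  assumes "full_support q1" and "full_support q2"
    and "(\<chi> x. 1) \<in> span (rows A1)" and "(\<chi> x. 1) \<in> span (rows A2)"
    and "signed_circuits A1 = signed_circuits A2"
  shows "{supp p | p. p \<in> closure (exp_family q1 A1)} = {supp p | p. p \<in> closure (exp_family q2 A2)}"
  using assms by (simp only: supports_closure_exp_family)

end
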